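(* Let $\alpha_1>0$ and $\alpha_2>0$ be two different constant drag coefficients, and for $i=1,2$ let $\{\mathbf{v}_i(\mathbf{x}),p_i(\mathbf{x})\}$ be a solution of $$\alpha_i\,\mathbf{v}_i(\mathbf{x}) + \mathrm{grad}[p_i(\mathbf{x})] = \rho\,\mathbf{b}(\mathbf{x}) \ \text{ in } \Omega, \qquad \mathrm{div}[\mathbf{v}_i(\mathbf{x})] = 0 \ \text{ in } \Omega, \qquad \mathbf{v}_i(\mathbf{x})\cdot\hat{\mathbf{n}}(\mathbf{x}) = v_n(\mathbf{x}) \ \text{ on } \partial\Omega,$$ with the same domain $\Omega$, the same conservative body force ($\rho\,\mathbf{b}=\mathrm{grad}[\phi]$ for some scalar potential field $\phi$ on $\Omega$) and the same velocity boundary data $v_n$. Then $$\int_{\Omega}\mathbf{v}_1(\mathbf{x})\cdot\mathbf{v}_1(\mathbf{x})\;\mathrm{d}\Omega = \int_{\Omega}\mathbf{v}_2(\mathbf{x})\cdot\mathbf{v}_2(\mathbf{x})\;\mathrm{d}\Omega .$$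
   Context: $\Omega\subset\mathbb{R}^{nd}$ is an open bounded set, $nd$ is the number of spatial dimensions, and the boundary $\partial\Omega=\overline{\Omega}\setminus\Omega$ is piecewise smooth with unit outward normal $\hat{\mathbf{n}}(\mathbf{x})$. The fields $\mathbf{v}_i:\Omega\to\mathbb{R}^{nd}$ are (Darcy) velocities, $p_i:\Omega\to\mathbb{R}$ are pressures, $\rho$ is the (constant) density, $\mathbf{b}$ is the specific body force, and $v_n$ is the prescribed normal component of the velocity, which is prescribed on the entire boundary (there is no part of the boundary where the pressure is prescribed). "Constant drag coefficient" means independent of velocity, pressure and position. All fields and the domain are understood to be regular enough that the integrals above exist and the divergence theorem (Green's identity) applies to them. *)

theory Defs
  imports "HOL-Analysis.Analysis"
begin

(* Both operators are meaningful only at points of differentiability;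
   every use below is guarded accordingly. *)

definition grad :: "(real ^ 'n \<Rightarrow> real) \<Rightarrow> real ^ 'n \<Rightarrow> real ^ 'n" where
  "grad f x = (\<chi> k. frechet_derivative f (at x) (axis k 1))"

definition divergence :: "(real ^ 'n \<Rightarrow> real ^ 'n) \<Rightarrow> real ^ 'n \<Rightarrow> real" where
  "divergence F x = (\<Sum>k\<in>UNIV. frechet_derivative F (at x) (axis k 1) $ k)"

(* Hausdorff measure with the normalisation for which it agrees with the classical surface
   area on C^1 hypersurfaces: a set of diameter d has size (volume of the unit s-ball) * (d/2)^s.
   The empty set is treated separately because of 0^0 = 1 (counting measure for s = 0). *)

definition hausdorff_size :: "nat \<Rightarrow> 'a::metric_space set \<Rightarrow> ennreal" where
  "hausdorff_size s U =
     (if U = {} then 0 else ennreal (unit_ball_vol (real s) * (diameter U / 2) ^ s))"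

definition hausdorff_pre :: "nat \<Rightarrow> real \<Rightarrow> 'a::metric_space set \<Rightarrow> ennreal" where
  "hausdorff_pre s \<delta> A =
     (INF U \<in> {U :: nat \<Rightarrow> 'a set. A \<subseteq> (\<Union>i. U i) \<and> (\<forall>i. bounded (U i) \<and> diameter (U i) \<le> \<delta>)}.
        \<Sum>i. hausdorff_size s (U i))"

definition hausdorff_outer :: "nat \<Rightarrow> 'a::metric_space set \<Rightarrow> ennreal" where
  "hausdorff_outer s A = (SUP \<delta> \<in> {0<..}. hausdorff_pre s \<delta> A)"

(* The outer measure above is a metric outer measure, hence countably additive on the Borel
   sets, so the measure below really takes the values given by it. *)

definition hausdorff_measure :: "nat \<Rightarrow> 'a::metric_space measure" where
  "hausdorff_measure s = measure_of UNIV (sets borel) (hausdorff_outer s)"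

(* Completed, so that values on null sets (such as edges and corners, where there is no normal)
   do not affect measurability. *)

definition surface_measure :: "(real ^ 'n) measure" where
  "surface_measure = completion (hausdorff_measure (CARD('n) - 1))"

(* Near a smooth boundary point the set is the sublevel set of a C^1 function without critical
   points; then the boundary is the level set, the set lies on one side of it, and the gradient
   points outwards. The condition g x = 0 makes x a boundary point. *)

definition local_defining_function ::
  "(real ^ 'n) set \<Rightarrow> real ^ 'n \<Rightarrow> (real ^ 'n) set \<Rightarrow> (real ^ 'n \<Rightarrow> real) \<Rightarrow> bool" where
  "local_defining_function \<Omega> x U g \<longleftrightarrow>
     open U \<and> x \<in> U \<and> g x = 0 \<and>
     (\<forall>y\<in>U. g differentiable (at y) \<and> grad g y \<noteq> 0) \<and> continuous_on U (grad g) \<and>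
     \<Omega> \<inter> U = {y \<in> U. g y < 0}"

definition smooth_boundary :: "(real ^ 'n) set \<Rightarrow> (real ^ 'n) set" where
  "smooth_boundary \<Omega> = {x. \<exists>U g. local_defining_function \<Omega> x U g}"

definition outward_unit_normal :: "(real ^ 'n) set \<Rightarrow> real ^ 'n \<Rightarrow> real ^ 'n \<Rightarrow> bool" where
  "outward_unit_normal \<Omega> x \<nu> \<longleftrightarrow>
     (\<exists>U g. local_defining_function \<Omega> x U g \<and> \<nu> = grad g x /\<^sub>R norm (grad g x))"

(* The exceptional set (edges, corners, ...) has zero surface measure. Finiteness of the
   number of smooth pieces is not required. *)

definition piecewise_smooth_boundary :: "(real ^ 'n) set \<Rightarrow> bool" where
  "piecewise_smooth_boundary \<Omega> \<longleftrightarrow>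
     frontier \<Omega> - smooth_boundary \<Omega> \<in> null_sets surface_measure"

definition divergence_theorem_applies ::
  "(real ^ 'n) set \<Rightarrow> (real ^ 'n \<Rightarrow> real ^ 'n) \<Rightarrow> (real ^ 'n \<Rightarrow> real ^ 'n) \<Rightarrow> bool" where
  "divergence_theorem_applies \<Omega> n F \<longleftrightarrow>
     set_integrable lebesgue \<Omega> (divergence F) \<and>
     set_integrable surface_measure (frontier \<Omega>) (\<lambda>x. F x \<bullet> n x) \<and>
     (LINT x:\<Omega>|lebesgue. divergence F x) = (LINT x:frontier \<Omega>|surface_measure. F x \<bullet> n x)"

(* Continuity up to the smooth part of the boundary makes the boundary values of the fields
   their traces; nothing is required at edges and corners. *)

definition darcy_solution ::
  "(real ^ 'n) set \<Rightarrow> (real ^ 'n \<Rightarrow> real ^ 'n) \<Rightarrow> real \<Rightarrow> real \<Rightarrow> (real ^ 'n \<Rightarrow> real ^ 'n) \<Rightarrow>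
   (real ^ 'n \<Rightarrow> real) \<Rightarrow> (real ^ 'n \<Rightarrow> real ^ 'n) \<Rightarrow> (real ^ 'n \<Rightarrow> real) \<Rightarrow> bool" where
  "darcy_solution \<Omega> n \<alpha> \<rho> b v\<^sub>n v p \<longleftrightarrow>
     continuous_on (\<Omega> \<union> smooth_boundary \<Omega>) v \<and> continuous_on (\<Omega> \<union> smooth_boundary \<Omega>) p \<and>
     (\<forall>x\<in>\<Omega>. v differentiable (at x) \<and> p differentiable (at x)) \<and>
     (\<forall>x\<in>\<Omega>. \<alpha> *\<^sub>R v x + grad p x = \<rho> *\<^sub>R b x) \<and>
     (\<forall>x\<in>\<Omega>. divergence v x = 0) \<and>
     (\<forall>x\<in>smooth_boundary \<Omega>. v x \<bullet> n x = v\<^sub>n x)"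

end

theory Submission
  imports Defs
begin

text \<open>The forces driving the flow are gradients: \<open>\<alpha>\<^sub>i v\<^sub>i = grad (\<phi> - p\<^sub>i)\<close>. Integrating a gradient
  \<open>grad q\<close> against a divergence-free field \<open>w\<close> gives, by the divergence theorem, the boundary integral
  of \<open>q (w \<bullet> n)\<close>, which sees \<open>w\<close> only through its normal trace. Both velocities have the same
  normal trace, so \<open>\<integral> grad q \<bullet> v\<^sub>1 = \<integral> grad q \<bullet> v\<^sub>2\<close> for every potential \<open>q\<close> among \<open>p\<^sub>1\<close>, \<open>p\<^sub>2\<close>, \<open>\<phi>\<close>
  (lemma \<open>integral_grad_inner_eq\<close>). Each \<open>v\<^sub>i\<close> being a linear combination of such gradients,
  \<open>\<integral> v\<^sub>i \<bullet> v\<^sub>1 = \<integral> v\<^sub>i \<bullet> v\<^sub>2\<close> for \<open>i = 1, 2\<close> (lemma \<open>integral_gradient_flow_inner_eq\<close>), and by symmetry of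
  the inner product both energies equal the mixed integral \<open>\<integral> v\<^sub>1 \<bullet> v\<^sub>2\<close>. In other words, \<open>v\<^sub>1 - v\<^sub>2\<close> is
  orthogonal to \<open>v\<^sub>1\<close> and to \<open>v\<^sub>2\<close>, so that in fact both drag coefficients give the same flow.\<close>

lemma divergence_scaleR:
  fixes q :: "real ^ 'n \<Rightarrow> real" and v :: "real ^ 'n \<Rightarrow> real ^ 'n"
  assumes q: "q differentiable (at x)" and v: "v differentiable (at x)"
  shows "divergence (\<lambda>x. q x *\<^sub>R v x) x = q x * divergence v x + grad q x \<bullet> v x"
proof -
  have "((\<lambda>x. q x *\<^sub>R v x) has_derivative
      (\<lambda>h. q x *\<^sub>R frechet_derivative v (at x) h + frechet_derivative q (at x) h *\<^sub>R v x)) (at x)"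
    using q v by (intro has_derivative_scaleR) (simp_all add: frechet_derivative_works[symmetric])
  then have "frechet_derivative (\<lambda>x. q x *\<^sub>R v x) (at x) =
      (\<lambda>h. q x *\<^sub>R frechet_derivative v (at x) h + frechet_derivative q (at x) h *\<^sub>R v x)"
    by (rule frechet_derivative_at[symmetric])
  then show ?thesis
    by (simp add: divergence_def grad_def inner_vec_def sum.distrib sum_distrib_left)
qed

text \<open>The edges and corners, where the normal traces are not controlled, form a null set.\<close>

lemma boundary_flux_eq:
  fixes \<Omega> :: "(real ^ 'n) set"
  assumes piecewise: "piecewise_smooth_boundary \<Omega>"
    and "set_integrable surface_measure (frontier \<Omega>) f"
    and "set_integrable surface_measure (frontier \<Omega>) g"
    and eq: "\<And>x. x \<in> smooth_boundary \<Omega> \<Longrightarrow> f x = (g x :: real)"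
  shows "(LINT x:frontier \<Omega>|surface_measure. f x) = (LINT x:frontier \<Omega>|surface_measure. g x)"
  unfolding set_lebesgue_integral_def
proof (rule integral_cong_AE)
  show "(\<lambda>x. indicator (frontier \<Omega>) x *\<^sub>R f x) \<in> borel_measurable surface_measure"
       "(\<lambda>x. indicator (frontier \<Omega>) x *\<^sub>R g x) \<in> borel_measurable surface_measure"
    using assms(2,3) by (auto simp: set_integrable_def)
  show "AE x in surface_measure.
      indicator (frontier \<Omega>) x *\<^sub>R f x = indicator (frontier \<Omega>) x *\<^sub>R g x"
    using piecewise unfolding piecewise_smooth_boundary_def
    by (rule AE_I') (auto simp: eq indicator_def)
qed

text \<open>For a divergence-free field the product rule leaves \<open>div (q w) = grad q \<bullet> w\<close>, so the divergence
  theorem is an integration by parts without a volume term.\<close>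

lemma integral_grad_inner:
  fixes \<Omega> :: "(real ^ 'n) set"
  assumes "open \<Omega>"
    and "\<And>x. x \<in> \<Omega> \<Longrightarrow> q differentiable (at x)"
    and "\<And>x. x \<in> \<Omega> \<Longrightarrow> w differentiable (at x)"
    and "\<And>x. x \<in> \<Omega> \<Longrightarrow> divergence w x = 0"
    and green: "divergence_theorem_applies \<Omega> n (\<lambda>x. q x *\<^sub>R w x)"
  shows "set_integrable lebesgue \<Omega> (\<lambda>x. grad q x \<bullet> w x)"
    and "(LINT x:\<Omega>|lebesgue. grad q x \<bullet> w x) =
         (LINT x:frontier \<Omega>|surface_measure. q x * (w x \<bullet> n x))"
proof -
  have div: "divergence (\<lambda>x. q x *\<^sub>R w x) x = grad q x \<bullet> w x" if "x \<in> \<Omega>" for x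
    using assms(2-4)[OF that] by (simp add: divergence_scaleR)
  have "set_integrable lebesgue \<Omega> (divergence (\<lambda>x. q x *\<^sub>R w x)) \<longleftrightarrow>
      set_integrable lebesgue \<Omega> (\<lambda>x. grad q x \<bullet> w x)"
    by (rule set_integrable_cong) (simp_all add: div)
  then show "set_integrable lebesgue \<Omega> (\<lambda>x. grad q x \<bullet> w x)"
    using green by (simp add: divergence_theorem_applies_def)
  have "(LINT x:\<Omega>|lebesgue. divergence (\<lambda>x. q x *\<^sub>R w x) x) = (LINT x:\<Omega>|lebesgue. grad q x \<bullet> w x)"
    using \<open>open \<Omega>\<close> by (intro set_lebesgue_integral_cong) (auto simp: div)
  then show "(LINT x:\<Omega>|lebesgue. grad q x \<bullet> w x) =
      (LINT x:frontier \<Omega>|surface_measure. q x * (w x \<bullet> n x))"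
    using green by (simp add: divergence_theorem_applies_def)
qed

text \<open>Gradients are orthogonal to divergence-free fields without normal trace; here the latter is the
  difference of \<open>w\<close> and \<open>w'\<close>.\<close>

lemma integral_grad_inner_eq:
  fixes \<Omega> :: "(real ^ 'n) set"
  assumes "open \<Omega>" and "piecewise_smooth_boundary \<Omega>"
    and "\<And>x. x \<in> \<Omega> \<Longrightarrow> q differentiable (at x)"
    and w: "\<And>x. x \<in> \<Omega> \<Longrightarrow> w differentiable (at x) \<and> divergence w x = 0"
    and w': "\<And>x. x \<in> \<Omega> \<Longrightarrow> w' differentiable (at x) \<and> divergence w' x = 0"
    and trace: "\<And>x. x \<in> smooth_boundary \<Omega> \<Longrightarrow> w x \<bullet> n x = w' x \<bullet> n x"
    and green: "divergence_theorem_applies \<Omega> n (\<lambda>x. q x *\<^sub>R w x)"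
               "divergence_theorem_applies \<Omega> n (\<lambda>x. q x *\<^sub>R w' x)"
  shows "(LINT x:\<Omega>|lebesgue. grad q x \<bullet> w x) = (LINT x:\<Omega>|lebesgue. grad q x \<bullet> w' x)"
proof -
  have "(LINT x:frontier \<Omega>|surface_measure. q x * (w x \<bullet> n x)) =
      (LINT x:frontier \<Omega>|surface_measure. q x * (w' x \<bullet> n x))"
    using assms(2) green trace
    by (intro boundary_flux_eq) (auto simp: divergence_theorem_applies_def)
  then show ?thesis
    using assms by (simp add: integral_grad_inner(2)[where n = n])
qed

text \<open>The potentials \<open>\<phi>\<close> and \<open>p\<close> enter separately, because integrability and the divergence theorem
  are supposed for each of them and not for the difference \<open>\<phi> - p\<close> that drives the flow.\<close>

lemma integral_gradient_flow_inner_eq: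
  fixes \<Omega> :: "(real ^ 'n) set"
  assumes "open \<Omega>" and "piecewise_smooth_boundary \<Omega>" and "\<alpha> \<noteq> 0"
    and flow: "\<And>x. x \<in> \<Omega> \<Longrightarrow> \<alpha> *\<^sub>R v x + grad p x = grad \<phi> x"
    and diff: "\<And>x q. x \<in> \<Omega> \<Longrightarrow> q \<in> {p, \<phi>} \<Longrightarrow> q differentiable (at x)"
    and field: "\<And>x u. x \<in> \<Omega> \<Longrightarrow> u \<in> {w, w'} \<Longrightarrow> u differentiable (at x) \<and> divergence u x = 0"
    and trace: "\<And>x. x \<in> smooth_boundary \<Omega> \<Longrightarrow> w x \<bullet> n x = w' x \<bullet> n x"
    and green: "\<And>q u. q \<in> {p, \<phi>} \<Longrightarrow> u \<in> {w, w'} \<Longrightarrow>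
                  divergence_theorem_applies \<Omega> n (\<lambda>x. q x *\<^sub>R u x)"
  shows "(LINT x:\<Omega>|lebesgue. v x \<bullet> w x) = (LINT x:\<Omega>|lebesgue. v x \<bullet> w' x)"
proof -
  have power: "\<alpha> * (LINT x:\<Omega>|lebesgue. v x \<bullet> u x) =
      (LINT x:\<Omega>|lebesgue. grad \<phi> x \<bullet> u x) - (LINT x:\<Omega>|lebesgue. grad p x \<bullet> u x)"
    if u: "u \<in> {w, w'}" for u
  proof -
    have int: "set_integrable lebesgue \<Omega> (\<lambda>x. grad q x \<bullet> u x)" if "q \<in> {p, \<phi>}" for q
      using \<open>open \<Omega>\<close> diff[OF _ that] field[OF _ u] green[OF that u]
      by (intro integral_grad_inner(1)[where n = n]) auto
    have "\<alpha> * (v x \<bullet> u x) = grad \<phi> x \<bullet> u x - grad p x \<bullet> u x" if "x \<in> \<Omega>" for x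
      using flow[OF that, symmetric] by (simp add: inner_add_left)
    then have "(LINT x:\<Omega>|lebesgue. \<alpha> * (v x \<bullet> u x)) =
        (LINT x:\<Omega>|lebesgue. grad \<phi> x \<bullet> u x - grad p x \<bullet> u x)"
      using \<open>open \<Omega>\<close> by (intro set_lebesgue_integral_cong) auto
    also have "\<dots> = (LINT x:\<Omega>|lebesgue. grad \<phi> x \<bullet> u x) - (LINT x:\<Omega>|lebesgue. grad p x \<bullet> u x)"
      by (intro set_integral_diff int) auto
    finally show ?thesis by simp
  qed
  have "(LINT x:\<Omega>|lebesgue. grad q x \<bullet> w x) = (LINT x:\<Omega>|lebesgue. grad q x \<bullet> w' x)"
    if "q \<in> {p, \<phi>}" for q
    using assms(1,2) diff[OF _ that] field trace green[OF that]
    by (intro integral_grad_inner_eq[where n = n]) auto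
  then have "\<alpha> * (LINT x:\<Omega>|lebesgue. v x \<bullet> w x) = \<alpha> * (LINT x:\<Omega>|lebesgue. v x \<bullet> w' x)"
    by (simp add: power)
  then show ?thesis
    using \<open>\<alpha> \<noteq> 0\<close> by simp
qed

theorem corollary5:
  fixes \<Omega> :: "(real ^ 'n) set"
    and n b v1 v2 :: "real ^ 'n \<Rightarrow> real ^ 'n"
    and p1 p2 \<phi> v\<^sub>n :: "real ^ 'n \<Rightarrow> real"
    and \<alpha>1 \<alpha>2 \<rho> :: real
  assumes "open \<Omega>" and "bounded \<Omega>"
    and "piecewise_smooth_boundary \<Omega>"
    and normal: "\<And>x. x \<in> smooth_boundary \<Omega> \<Longrightarrow> outward_unit_normal \<Omega> x (n x)"
    and "\<alpha>1 > 0" and "\<alpha>2 > 0" and "\<alpha>1 \<noteq> \<alpha>2"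
    and sol1: "darcy_solution \<Omega> n \<alpha>1 \<rho> b v\<^sub>n v1 p1"
    and sol2: "darcy_solution \<Omega> n \<alpha>2 \<rho> b v\<^sub>n v2 p2"
    and potential_regular: "continuous_on (\<Omega> \<union> smooth_boundary \<Omega>) \<phi>"
    and conservative: "\<And>x. x \<in> \<Omega> \<Longrightarrow> \<phi> differentiable (at x) \<and> \<rho> *\<^sub>R b x = grad \<phi> x"
    and integrable1: "set_integrable lebesgue \<Omega> (\<lambda>x. v1 x \<bullet> v1 x)"
    and integrable2: "set_integrable lebesgue \<Omega> (\<lambda>x. v2 x \<bullet> v2 x)"
    and green: "\<And>q v. q \<in> {p1, p2, \<phi>} \<Longrightarrow> v \<in> {v1, v2} \<Longrightarrow>
                  divergence_theorem_applies \<Omega> n (\<lambda>x. q x *\<^sub>R v x)"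
  shows "(LINT x:\<Omega>|lebesgue. v1 x \<bullet> v1 x) = (LINT x:\<Omega>|lebesgue. v2 x \<bullet> v2 x)"
proof -
  have flow: "\<alpha>1 *\<^sub>R v1 x + grad p1 x = grad \<phi> x" "\<alpha>2 *\<^sub>R v2 x + grad p2 x = grad \<phi> x"
    if "x \<in> \<Omega>" for x
    using that sol1 sol2 conservative by (auto simp: darcy_solution_def)
  have diff: "q differentiable (at x)" if "x \<in> \<Omega>" "q \<in> {p1, p2, \<phi>}" for x q
    using that sol1 sol2 conservative by (auto simp: darcy_solution_def)
  have field: "u differentiable (at x) \<and> divergence u x = 0" if "x \<in> \<Omega>" "u \<in> {v1, v2}" for x u
    using that sol1 sol2 by (auto simp: darcy_solution_def)
  have trace: "v1 x \<bullet> n x = v2 x \<bullet> n x" if "x \<in> smooth_boundary \<Omega>" for x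
    using that sol1 sol2 by (auto simp: darcy_solution_def)
  have "(LINT x:\<Omega>|lebesgue. v1 x \<bullet> v1 x) = (LINT x:\<Omega>|lebesgue. v1 x \<bullet> v2 x)"
    using \<open>\<alpha>1 > 0\<close>
    by (intro integral_gradient_flow_inner_eq[OF assms(1,3) _ flow(1) diff field trace green]) auto
  also have "\<dots> = (LINT x:\<Omega>|lebesgue. v2 x \<bullet> v1 x)"
    by (simp add: inner_commute)
  also have "\<dots> = (LINT x:\<Omega>|lebesgue. v2 x \<bullet> v2 x)"
    using \<open>\<alpha>2 > 0\<close>
    by (intro integral_gradient_flow_inner_eq[OF assms(1,3) _ flow(2) diff field trace green]) auto
  finally show ?thesis .
qed

end
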